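(* Let $P(x) \in \mathbb{Z}[x]$ be a polynomial. Then the set of primes $p$ such that there exists $n \in \mathbb{Z}$ such that $p \mid P(n)$ is infinite.
   Formalization: The polynomial P is assumed to be zero or non-constant; for a nonzero constant, such as P = 1, only the finitely many prime divisors of that constant divide a value, so the claim fails there. *)

theory Defs
  imports "HOL-Computational_Algebra.Computational_Algebra"
begin

end

theory Submission
  imports Defs
begin

text \<open>
  The argument follows Euclid. Let \<open>c = P(0)\<close>. If \<open>c = 0\<close>, every prime divides \<open>P(0)\<close>. Otherwise
  suppose that only finitely many primes divide values of \<open>P\<close>, and let \<open>N\<close> be their product. Every
  non-constant term of \<open>P(cNt)\<close> is divisible by \<open>cN\<close>, so \<open>P(cNt) = c(1 + Nk)\<close> for some integer \<open>k\<close>.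
  The factor \<open>1 + Nk\<close> is coprime to all primes in the list, and yet it is a divisor of a value of
  \<open>P\<close>; so it must be a unit, that is, \<open>P(cNt) = \<plusminus>c\<close> for every \<open>t\<close>. A non-constant polynomial takes
  each value only finitely often, which is a contradiction.
\<close>

lemma finite_poly_eq:
  fixes P :: "'a :: {comm_ring_1, ring_no_zero_divisors} poly"
  assumes "degree P > 0"
  shows "finite {x. poly P x = a}"
proof -
  have "P - [:a:] \<noteq> 0"
    using assms by auto
  from poly_roots_finite[OF this] show ?thesis
    by simp
qed

theorem theorem1p1:
  fixes P :: "int poly"
  assumes "P = 0 \<or> degree P > 0"
  shows "infinite {p :: nat. prime p \<and> (\<exists>n :: int. int p dvd poly P n)}"
proof (cases "poly P 0 = 0")
  case True
  then have "{p :: nat. prime p \<and> (\<exists>n :: int. int p dvd poly P n)} = {p. prime p}"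
    by (metis dvd_0_right)
  then show ?thesis
    using primes_infinite by simp
next
  case False
  define S where "S = {p :: nat. prime p \<and> (\<exists>n :: int. int p dvd poly P n)}"
  have "infinite S"
  proof
    assume fin: "finite S"
    obtain c R where P: "P = pCons c R"
      by (cases P)
    with False have c: "c \<noteq> 0"
      by simp
    have deg: "degree P > 0"
      using assms False by auto
    define N where "N = int (\<Prod>S)"
    have N: "N \<noteq> 0"
      using fin by (auto simp: N_def S_def)
    have "inj (\<lambda>t. c * N * t)"
      using c N by (auto intro!: injI)
    then have "infinite (range (\<lambda>t. c * N * t))"
      by (simp add: finite_image_iff infinite_UNIV_int)
    moreover have "finite ({x. poly P x = c} \<union> {x. poly P x = - c})"
      using finite_poly_eq[OF deg] by simp
    ultimately obtain t where t: "poly P (c * N * t) \<noteq> c" "poly P (c * N * t) \<noteq> - c"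
      by (smt (verit) UnCI finite_subset imageE mem_Collect_eq subsetI)
    define u where "u = 1 + N * (t * poly R (c * N * t))"
    have Pu: "poly P (c * N * t) = c * u"
      by (simp add: P u_def algebra_simps)
    with t have "\<bar>u\<bar> \<noteq> 1"
      by (auto simp: abs_if split: if_splits)
    then have "nat \<bar>u\<bar> \<noteq> 1"
      by linarith
    then obtain q where q: "prime q" "q dvd nat \<bar>u\<bar>"
      using prime_factor_nat by blast
    then have qu: "int q dvd u"
      by (simp add: int_dvd_int_iff[symmetric])
    then have "int q dvd poly P (c * N * t)"
      by (simp add: Pu)
    with q have "q \<in> S"
      by (auto simp: S_def)
    then have "int q dvd N"
      using fin unfolding N_def int_dvd_int_iff by (intro dvd_prodI[of S q "\<lambda>x. x", simplified]) auto
    then have "int q dvd 1"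
      using qu unfolding u_def by (metis dvd_add_left_iff dvd_mult2)
    with q show False
      by simp
  qed
  then show ?thesis
    by (simp add: S_def)
qed

end
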